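(* Let $1 \le r < n$ be integers and let $\mathcal{G}_n^r$ be the Grassmann manifold of $r$-dimensional linear subspaces of $\mathbb{R}^n$. A kernel $k : \mathcal{G}_n^r \times \mathcal{G}_n^r \to \mathbb{R}$ is radial with respect to the projection distance $d_P$ and is positive definite if it admits a series representation of the form $$k([Y_1],[Y_2]) = \sum_{i=0}^{\infty} a_i \langle \hat{Y}_1, \hat{Y}_2\rangle_F^{\,i} + a_{-1}\, 1_{\{1\}}\big(\langle \hat{Y}_1, \hat{Y}_2\rangle_F\big) \quad \text{for all } [Y_1],[Y_2]\in\mathcal{G}_n^r,$$ where $(a_i)_{i\ge -1}$ are real numbers with $a_i \ge 0$ for all $i$ and $\sum_{i\ge -1} a_i < \infty$.
   Context: A point of $\mathcal{G}_n^r$ is represented by an $n\times r$ real matrix $Y$ with orthonormal columns ($Y^TY = I_r$); $[Y]$ denotes the column span of $Y$. For such $Y$, set $\hat{Y} = YY^T/\sqrt{r}$ (this depends only on $[Y]$). $\langle\cdot,\cdot\rangle_F$ is the Frobenius inner product of matrices and $\|\cdot\|_F$ the Frobenius norm. The projection distance is $$d_P([Y_1],[Y_2]) = 2^{-1/2}\,\|Y_1Y_1^T - Y_2Y_2^T\|_F .$$ $1_A(t)$ is the indicator function: $1_A(t)=1$ if $t\in A$ and $0$ otherwise. The $i=0$ power is the constant $1$ (convention $0^0=1$). A kernel on a nonempty set $\mathcal{X}$ is a function $f:\mathcal{X}\times\mathcal{X}\to\mathbb{R}$. It is positive definite if it is symmetric and $\sum_{i,j=1}^m c_ic_jf(x_i,x_j)\ge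 0$ for all $m\in\mathbb{N}$, $x_1,\dots,x_m\in\mathcal{X}$, $c_1,\dots,c_m\in\mathbb{R}$. A kernel $k$ on a metric space $(M,d)$ is radial (with respect to $d$) if there is a function $\varphi:[0,\infty)\to\mathbb{R}$ with $k(x,y)=\varphi(d(x,y))$ for all $x,y\in M$. *)

theory Defs
  imports "HOL-Analysis.Analysis"
begin

text \<open>
  Matrices are vectors of rows, so \<open>real^'r^'n\<close> is the type of \<open>n \<times> r\<close> matrices with
  \<open>n = CARD('n)\<close> and \<open>r = CARD('r)\<close>. The library's inner product and norm on \<open>real^'n^'n\<close> are
  entrywise Euclidean, i.e. exactly the Frobenius inner product and the Frobenius norm.
\<close>

lemma frobenius_inner: "A \<bullet> B = (\<Sum>i\<in>UNIV. \<Sum>j\<in>UNIV. A $ i $ j * B $ i $ j)"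
  for A B :: "real^'m^'n"
  by (simp add: inner_vec_def)

lemma frobenius_norm: "norm A = sqrt (\<Sum>i\<in>UNIV. \<Sum>j\<in>UNIV. (A $ i $ j)\<^sup>2)"
  for A :: "real^'m^'n"
  by (simp add: norm_eq_sqrt_inner frobenius_inner power2_eq_square)


subsection \<open>Kernels\<close>

definition positive_definite_kernel :: "'a set \<Rightarrow> ('a \<Rightarrow> 'a \<Rightarrow> real) \<Rightarrow> bool" where
  "positive_definite_kernel X f \<longleftrightarrow>
     (\<forall>x\<in>X. \<forall>y\<in>X. f x y = f y x) \<and>
     (\<forall>(m::nat) (x :: nat \<Rightarrow> 'a) (c :: nat \<Rightarrow> real). (\<forall>i<m. x i \<in> X) \<longrightarrow>
        (\<Sum>i<m. \<Sum>j<m. c i * c j * f (x i) (x j)) \<ge> 0)"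

text \<open>Only the values of \<open>\<phi>\<close> on \<open>[0,\<infinity>)\<close> matter when \<open>d\<close> is a metric on \<open>M\<close>.\<close>

definition radial_kernel :: "'a set \<Rightarrow> ('a \<Rightarrow> 'a \<Rightarrow> real) \<Rightarrow> ('a \<Rightarrow> 'a \<Rightarrow> real) \<Rightarrow> bool" where
  "radial_kernel M d k \<longleftrightarrow> (\<exists>\<phi> :: real \<Rightarrow> real. \<forall>x\<in>M. \<forall>y\<in>M. k x y = \<phi> (d x y))"


subsection \<open>The Grassmann manifold\<close>

definition grassmannian :: "nat \<Rightarrow> (real^'n) set set" where
  "grassmannian r = {S. subspace S \<and> dim S = r}"

definition orthonormal_columns :: "real^'r^'n \<Rightarrow> bool" where
  "orthonormal_columns Y \<longleftrightarrow> transpose Y ** Y = mat 1"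

definition column_span :: "real^'r^'n \<Rightarrow> (real^'n) set" where
  "column_span Y = span (columns Y)"

definition normalized_projection :: "real^'r^'n \<Rightarrow> real^'n^'n" where
  "normalized_projection Y = (1 / sqrt (real CARD('r))) *\<^sub>R (Y ** transpose Y)"

text \<open>
  The matrix \<open>Y ** transpose Y\<close> depends only on \<open>column_span Y\<close> (\<open>projection_matrix_eq\<close> below).
  The argument of type \<open>'r itself\<close> fixes the number of columns of the representing matrices.
\<close>

definition projection_matrix :: "'r::finite itself \<Rightarrow> (real^'n) set \<Rightarrow> real^'n^'n" where
  "projection_matrix _ S =
     (THE P. \<exists>Y :: real^'r^'n. orthonormal_columns Y \<and> column_span Y = S \<and> P = Y ** transpose Y)"

definition projection_distance ::
    "'r::finite itself \<Rightarrow> (real^'n) set \<Rightarrow> (real^'n) set \<Rightarrow> real" where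
  "projection_distance r S T =
     2 powr (- 1 / 2) * norm (projection_matrix r S - projection_matrix r T)"

lemma column_span_eq_range: "column_span Y = range ((*v) Y)" for Y :: "real^'r^'n"
proof
  have "columns Y \<subseteq> range ((*v) Y)"
    by (auto simp: columns_def matrix_vector_mul_component simp flip: matrix_vector_mult_basis)
  moreover have "subspace (range ((*v) Y))"
    by (simp add: linear_subspace_image)
  ultimately show "column_span Y \<subseteq> range ((*v) Y)"
    unfolding column_span_def by (rule span_minimal)
  show "range ((*v) Y) \<subseteq> column_span Y"
    unfolding column_span_def by (auto intro: matrix_vector_mult_in_columnspace)
qed

lemma column_span_eq_range_projection:
  fixes Y :: "real^'r^'n"
  assumes "orthonormal_columns Y"
  shows "column_span Y = range ((*v) (Y ** transpose Y))"
proof -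
  have "Y *v v = (Y ** transpose Y) *v (Y *v v)" for v
    using assms unfolding orthonormal_columns_def
    by (metis matrix_mul_assoc matrix_mul_rid matrix_vector_mul_assoc)
  then show ?thesis
    unfolding column_span_eq_range by (auto simp flip: matrix_vector_mul_assoc)
qed

lemma projection_eq_iff:
  fixes Y Z :: "real^'r^'n"
  assumes Y: "orthonormal_columns Y" and Z: "orthonormal_columns Z"
  shows "Y ** transpose Y = Z ** transpose Z \<longleftrightarrow> column_span Y = column_span Z"
proof
  assume "Y ** transpose Y = Z ** transpose Z"
  then show "column_span Y = column_span Z"
    by (simp add: column_span_eq_range_projection Y Z)
next
  have absorb: "(A ** transpose A) ** (B ** transpose B) = B ** transpose B"
    if A: "orthonormal_columns A" and "column_span A = column_span B"
    for A B :: "real^'r^'n"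
  proof -
    have "(A ** transpose A) *v (B *v v) = B *v v" for v
    proof -
      obtain w where w: "B *v v = A *v w"
        using \<open>column_span A = column_span B\<close> unfolding column_span_eq_range by blast
      show ?thesis
        using A unfolding w orthonormal_columns_def
        by (metis matrix_mul_assoc matrix_mul_rid matrix_vector_mul_assoc)
    qed
    then show ?thesis
      by (simp add: matrix_eq flip: matrix_vector_mul_assoc)
  qed
  assume eq: "column_span Y = column_span Z"
  have "Y ** transpose Y = transpose ((Z ** transpose Z) ** (Y ** transpose Y))"
    using absorb[OF Z eq[symmetric]] by (simp add: matrix_transpose_mul)
  also have "\<dots> = (Y ** transpose Y) ** (Z ** transpose Z)"
    by (simp add: matrix_transpose_mul)
  also have "\<dots> = Z ** transpose Z"
    by (rule absorb[OF Y eq])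
  finally show "Y ** transpose Y = Z ** transpose Z" .
qed

lemma projection_matrix_eq:
  fixes Y :: "real^'r^'n"
  assumes "orthonormal_columns Y"
  shows "projection_matrix TYPE('r) (column_span Y) = Y ** transpose Y"
  unfolding projection_matrix_def
  using assms projection_eq_iff by (intro the_equality) blast+

lemma projection_distance_eq:
  fixes Y1 Y2 :: "real^'r^'n"
  assumes "orthonormal_columns Y1" "orthonormal_columns Y2"
  shows "projection_distance TYPE('r) (column_span Y1) (column_span Y2) =
           2 powr (- 1 / 2) * norm (Y1 ** transpose Y1 - Y2 ** transpose Y2)"
  by (simp add: projection_distance_def projection_matrix_eq assms)

lemma grassmannian_eq_column_spans:
  "grassmannian CARD('r) = column_span ` {Y :: real^'r^'n. orthonormal_columns Y}"
proof (intro subset_antisym subsetI)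
  fix S :: "(real^'n) set"
  assume "S \<in> grassmannian CARD('r)"
  then have S: "subspace S" "dim S = CARD('r)"
    by (auto simp: grassmannian_def)
  obtain B where B: "B \<subseteq> S" "pairwise orthogonal B" "\<And>x. x \<in> B \<Longrightarrow> norm x = 1"
      "independent B" "card B = dim S" "span B = S"
    using orthonormal_basis_subspace[OF S(1)] by metis
  have "finite B"
    using B(4) independent_imp_finite by blast
  then obtain f :: "'r \<Rightarrow> real^'n" where f: "bij_betw f UNIV B"
    using B(5) S(2) by (metis finite_class.finite_UNIV finite_same_card_bij)
  define Y :: "real^'r^'n" where "Y = (\<chi> i j. f j $ i)"
  have col: "column j Y = f j" for j
    by (simp add: Y_def column_def)
  have "columns Y = B"
    using f by (auto simp: columns_def col bij_betw_def)
  then have "column_span Y = S"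
    by (simp add: column_span_def B(6))
  moreover have "f i \<bullet> f j = (if i = j then 1 else 0)" for i j
  proof -
    have "f i \<in> B" "f j \<in> B" "i \<noteq> j \<Longrightarrow> f i \<noteq> f j"
      using f by (auto simp: bij_betw_def inj_def)
    then show ?thesis
      using B(2,3) by (auto simp: pairwise_def orthogonal_def norm_eq_1)
  qed
  then have "orthonormal_columns Y"
    by (simp add: orthonormal_columns_def vec_eq_iff mat_def matrix_matrix_mult_def
        transpose_def Y_def inner_vec_def)
  ultimately show "S \<in> column_span ` {Y :: real^'r^'n. orthonormal_columns Y}"
    by blast
next
  fix S :: "(real^'n) set"
  assume "S \<in> column_span ` {Y :: real^'r^'n. orthonormal_columns Y}"
  then obtain Y :: "real^'r^'n" where Y: "orthonormal_columns Y" "S = column_span Y"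
    by blast
  have "inj ((*v) Y)"
    using Y(1) unfolding orthonormal_columns_def
    by (metis matrix_left_invertible_injective)
  then have "dim S = CARD('r)"
    unfolding Y(2) column_span_eq_range
    by (metis dim_UNIV dim_image_eq matrix_vector_mul_linear span_UNIV DIM_cart DIM_real mult.right_neutral)
  then show "S \<in> grassmannian CARD('r)"
    by (simp add: grassmannian_def Y(2) column_span_def)
qed

lemma Metric_space_projection_distance:
  "Metric_space (grassmannian CARD('r) :: (real^'n) set set) (projection_distance TYPE('r::finite))"
proof
  fix S T U :: "(real^'n) set"
  show "0 \<le> projection_distance TYPE('r) S T"
    and "projection_distance TYPE('r) S T = projection_distance TYPE('r) T S"
    by (auto simp: projection_distance_def norm_minus_commute)
  show "projection_distance TYPE('r) S T = 0 \<longleftrightarrow> S = T"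
    if "S \<in> grassmannian CARD('r)" "T \<in> grassmannian CARD('r)"
    using that unfolding grassmannian_eq_column_spans
    by (auto simp: projection_distance_eq projection_eq_iff)
  show "projection_distance TYPE('r) S U
          \<le> projection_distance TYPE('r) S T + projection_distance TYPE('r) T U"
    unfolding projection_distance_def distrib_left[symmetric]
    by (intro mult_left_mono) (auto simp flip: dist_norm intro: dist_triangle)
qed

end

theory Submission
  imports Defs
begin

text \<open>
  The matrices \<open>normalized_projection Y\<close> are unit vectors, so their inner product \<open>t\<close> is determined by
  their distance, \<open>d\<^sup>2 = r (1 - t)\<close> for the projection distance \<open>d\<close>; this gives radiality.
  Moreover, every kernel of the given form in the inner product is positive definite on the unit
  sphere of a Euclidean space (Schoenberg's easy direction): powers of the inner product are positive
  definite by the Schur product theorem, nonnegative series preserve this, and \<open>t = 1\<close> holds for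
  unit vectors exactly when they coincide. The kernel on the Grassmannian is a pullback of such a
  kernel.
\<close>

text \<open>Both clauses of the definition evaluate the kernel only at points of \<open>X\<close>.
  This allows replacing a kernel by a formula that agrees with it only on the sphere or only on the
  Grassmannian.\<close>

lemma positive_definite_kernel_cong:
  assumes "\<And>x y. x \<in> X \<Longrightarrow> y \<in> X \<Longrightarrow> f x y = g x y"
  shows "positive_definite_kernel X f \<longleftrightarrow> positive_definite_kernel X g"
proof -
  have "(\<Sum>i<m. \<Sum>j<m. c i * c j * f (x i) (x j)) = (\<Sum>i<m. \<Sum>j<m. c i * c j * g (x i) (x j))"
    if "\<forall>i<m. x i \<in> X" for m and x :: "nat \<Rightarrow> 'a" and c :: "nat \<Rightarrow> real"
    using that assms by (intro sum.cong) auto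
  then show ?thesis
    using assms by (simp add: positive_definite_kernel_def)
qed

text \<open>The points of a family in the definition may repeat, so composing a family in
  \<open>Y\<close> with \<open>g\<close> gives an admissible family in \<open>X\<close> with the
  same quadratic form.\<close>

lemma positive_definite_kernel_pullback:
  assumes "positive_definite_kernel X f" and "\<And>y. y \<in> Y \<Longrightarrow> g y \<in> X"
  shows "positive_definite_kernel Y (\<lambda>x y. f (g x) (g y))"
  unfolding positive_definite_kernel_def
proof (intro conjI allI impI ballI)
  fix x y assume "x \<in> Y" "y \<in> Y"
  then show "f (g x) (g y) = f (g y) (g x)"
    using assms by (auto simp: positive_definite_kernel_def)
next
  fix m :: nat and x :: "nat \<Rightarrow> 'b" and c :: "nat \<Rightarrow> real"
  assume "\<forall>i<m. x i \<in> Y"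
  then have "\<forall>i<m. (g \<circ> x) i \<in> X"
    using assms(2) by simp
  then have "0 \<le> (\<Sum>i<m. \<Sum>j<m. c i * c j * f ((g \<circ> x) i) ((g \<circ> x) j))"
    using assms(1) by (simp only: positive_definite_kernel_def)
  then show "0 \<le> (\<Sum>i<m. \<Sum>j<m. c i * c j * f (g (x i)) (g (x j)))"
    by simp
qed

lemma positive_definite_kernel_add:
  assumes "positive_definite_kernel X f" and "positive_definite_kernel X g"
  shows "positive_definite_kernel X (\<lambda>x y. f x y + g x y)"
  using assms by (simp add: positive_definite_kernel_def distrib_left sum.distrib)

lemma positive_definite_kernel_scale:
  assumes "positive_definite_kernel X f" and "a \<ge> 0"
  shows "positive_definite_kernel X (\<lambda>x y. a * f x y)"
proof -
  have "(\<Sum>i<m. \<Sum>j<m. c i * c j * (a * f (x i) (x j)))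
      = a * (\<Sum>i<m. \<Sum>j<m. c i * c j * f (x i) (x j))"
    for m and x :: "nat \<Rightarrow> 'a" and c :: "nat \<Rightarrow> real"
    by (simp add: sum_distrib_left ac_simps)
  then show ?thesis
    using assms by (simp add: positive_definite_kernel_def)
qed

text \<open>The quadratic form is a finite sum, so it commutes with the series and becomes a
  convergent series of nonnegative quadratic forms.\<close>

lemma positive_definite_kernel_suminf:
  fixes f :: "nat \<Rightarrow> 'a \<Rightarrow> 'a \<Rightarrow> real"
  assumes pd: "\<And>p. positive_definite_kernel X (f p)"
    and summable: "\<And>x y. x \<in> X \<Longrightarrow> y \<in> X \<Longrightarrow> summable (\<lambda>p. f p x y)"
  shows "positive_definite_kernel X (\<lambda>x y. \<Sum>p. f p x y)"
  unfolding positive_definite_kernel_def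
proof (intro conjI allI impI ballI)
  fix x y assume "x \<in> X" "y \<in> X"
  then show "(\<Sum>p. f p x y) = (\<Sum>p. f p y x)"
    using pd by (simp add: positive_definite_kernel_def)
next
  fix m :: nat and x :: "nat \<Rightarrow> 'a" and c :: "nat \<Rightarrow> real"
  assume x: "\<forall>i<m. x i \<in> X"
  have sums: "(\<lambda>p. \<Sum>i<m. \<Sum>j<m. c i * c j * f p (x i) (x j)) sums
      (\<Sum>i<m. \<Sum>j<m. c i * c j * (\<Sum>p. f p (x i) (x j)))"
    using x summable by (intro sums_sum sums_mult summable_sums) auto
  have nonneg: "0 \<le> (\<Sum>i<m. \<Sum>j<m. c i * c j * f p (x i) (x j))" for p
    using pd[of p] x by (simp add: positive_definite_kernel_def)
  show "0 \<le> (\<Sum>i<m. \<Sum>j<m. c i * c j * (\<Sum>p. f p (x i) (x j)))"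
    by (rule sums_le[OF nonneg sums_zero sums])
qed

lemma positive_definite_kernel_inner_power:
  "positive_definite_kernel X (\<lambda>x y. (x \<bullet> y) ^ p)" for X :: "'a::euclidean_space set"
proof -
  have "0 \<le> (\<Sum>i<m. \<Sum>j<m. c i * c j * (x i \<bullet> x j) ^ p)"
    for m and x :: "nat \<Rightarrow> 'a" and c :: "nat \<Rightarrow> real"
  \<comment> \<open>The coefficients must vary: the step applies the hypothesis with
    \<open>c i * (x i \<bullet> b)\<close> in place of \<open>c i\<close>, once for each basis
    vector \<open>b\<close>.\<close>
  proof (induction p arbitrary: c)
    case 0
    \<comment> \<open>Since \<open>0 ^ 0 = 1\<close>, the kernel is the constant 1 even at
      orthogonal points.\<close>
    have "(\<Sum>i<m. \<Sum>j<m. c i * c j) = (\<Sum>i<m. c i)\<^sup>2"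
      by (simp add: power2_eq_square sum_product)
    then show ?case
      by simp
  next
    case (Suc p)
    \<comment> \<open>Expanding one factor in coordinates absorbs it into the coefficients.\<close>
    have "(\<Sum>i<m. \<Sum>j<m. c i * c j * (x i \<bullet> x j) ^ Suc p)
        = (\<Sum>i<m. \<Sum>j<m. \<Sum>b\<in>Basis.
            (c i * (x i \<bullet> b)) * (c j * (x j \<bullet> b)) * (x i \<bullet> x j) ^ p)"
    proof (intro sum.cong refl)
      fix i j
      have "c i * c j * (x i \<bullet> x j) ^ Suc p
          = (\<Sum>b\<in>Basis. (x i \<bullet> b) * (x j \<bullet> b)) * (c i * c j * (x i \<bullet> x j) ^ p)"
        by (simp flip: euclidean_inner)
      then show "c i * c j * (x i \<bullet> x j) ^ Suc p
          = (\<Sum>b\<in>Basis. (c i * (x i \<bullet> b)) * (c j * (x j \<bullet> b)) * (x i \<bullet> x j) ^ p)"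
        by (simp only: sum_distrib_left ac_simps)
    qed
    also have "\<dots> = (\<Sum>b\<in>Basis. \<Sum>i<m. \<Sum>j<m.
            (c i * (x i \<bullet> b)) * (c j * (x j \<bullet> b)) * (x i \<bullet> x j) ^ p)"
      by (simp only: sum.swap[of _ Basis "{..<m}"])
    also have "\<dots> \<ge> 0"
      by (intro sum_nonneg Suc.IH)
    finally show ?case .
  qed
  then show ?thesis
    by (simp add: positive_definite_kernel_def inner_commute)
qed

text \<open>Grouping the indices by the value of \<open>x i\<close> turns the quadratic form into a
  sum of squares, one for each distinct value: the square of the total coefficient at that
  value.\<close>

lemma positive_definite_kernel_eq:
  "positive_definite_kernel X (\<lambda>x y. of_bool (x = y))"
proof -
  have "0 \<le> (\<Sum>i<m. \<Sum>j<m. c i * c j * of_bool (x i = x j))"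
    for m and x :: "nat \<Rightarrow> 'a" and c :: "nat \<Rightarrow> real"
  proof -
    define V where "V = x ` {..<m}"
    have "(\<Sum>i<m. \<Sum>j<m. c i * c j * of_bool (x i = x j))
        = (\<Sum>i<m. \<Sum>j<m. \<Sum>v\<in>V. (c i * of_bool (x i = v)) * (c j * of_bool (x j = v)))"
    proof (intro sum.cong refl)
      fix i j assume "i \<in> {..<m}"
      then have "x i \<in> V" and "finite V"
        by (auto simp: V_def)
      have "(\<Sum>v\<in>V. (c i * of_bool (x i = v)) * (c j * of_bool (x j = v)))
          = (\<Sum>v\<in>V. if x i = v then c i * c j * of_bool (x i = x j) else 0)"
        by (intro sum.cong) auto
      also have "\<dots> = c i * c j * of_bool (x i = x j)"
        using \<open>x i \<in> V\<close> \<open>finite V\<close> by simp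
      finally show "c i * c j * of_bool (x i = x j)
          = (\<Sum>v\<in>V. (c i * of_bool (x i = v)) * (c j * of_bool (x j = v)))" ..
    qed
    also have "\<dots> = (\<Sum>v\<in>V. (\<Sum>i<m. c i * of_bool (x i = v))\<^sup>2)"
      by (simp only: sum.swap[of _ V "{..<m}"] power2_eq_square sum_product)
    also have "\<dots> \<ge> 0"
      by (simp add: sum_nonneg)
    finally show ?thesis .
  qed
  then show ?thesis
    by (auto simp: positive_definite_kernel_def)
qed

text \<open>For unit vectors, polarization gives
  \<open>x \<bullet> y = 1 - (norm (x - y))\<^sup>2 / 2\<close>.\<close>

lemma inner_eq_1_iff:
  fixes x y :: "'a::real_inner"
  assumes "norm x = 1" "norm y = 1"
  shows "x \<bullet> y = 1 \<longleftrightarrow> x = y"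
  using assms by (simp add: dot_norm_neg)

lemma positive_definite_kernel_sphere:
  fixes a :: "nat \<Rightarrow> real" and b :: real
  assumes "\<And>p. a p \<ge> 0" and "b \<ge> 0" and "summable a"
  shows "positive_definite_kernel (sphere (0 :: 'a::euclidean_space) 1)
           (\<lambda>x y. (\<Sum>p. a p * (x \<bullet> y) ^ p) + b * indicator {1} (x \<bullet> y))"
proof (rule positive_definite_kernel_add)
  show "positive_definite_kernel (sphere (0::'a) 1) (\<lambda>x y. \<Sum>p. a p * (x \<bullet> y) ^ p)"
  proof (rule positive_definite_kernel_suminf)
    show "positive_definite_kernel (sphere (0::'a) 1) (\<lambda>x y. a p * (x \<bullet> y) ^ p)" for p
      using positive_definite_kernel_inner_power assms(1) by (rule positive_definite_kernel_scale)
  next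
    fix x y :: 'a
    assume "x \<in> sphere 0 1" "y \<in> sphere 0 1"
    \<comment> \<open>By Cauchy-Schwarz the series is dominated termwise by
      \<open>a\<close>.\<close>
    then have "\<bar>x \<bullet> y\<bar> \<le> 1"
      using Cauchy_Schwarz_ineq2[of x y] by simp
    then have "norm (a p * (x \<bullet> y) ^ p) \<le> a p" for p
      using assms(1)[of p] by (simp add: abs_mult power_abs mult_left_le power_le_one)
    then show "summable (\<lambda>p. a p * (x \<bullet> y) ^ p)"
      by (intro summable_comparison_test[OF _ assms(3)]) blast
  qed
next
  have "positive_definite_kernel (sphere (0::'a) 1) (\<lambda>x y. indicator {1} (x \<bullet> y))
      \<longleftrightarrow> positive_definite_kernel (sphere (0::'a) 1) (\<lambda>x y. of_bool (x = y))"
    by (intro positive_definite_kernel_cong) (simp add: inner_eq_1_iff indicator_def)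
  then show "positive_definite_kernel (sphere (0::'a) 1) (\<lambda>x y. b * indicator {1} (x \<bullet> y))"
    using assms(2) by (simp add: positive_definite_kernel_eq positive_definite_kernel_scale)
qed

text \<open>Both sides are the same fourfold sum in a different order, that is, the cyclic
  invariance of the trace. For orthonormal columns the right-hand side involves only the identity
  matrix of size \<open>CARD('r)\<close>.\<close>

lemma inner_matrix_transpose_self:
  fixes Y :: "real^'r^'n"
  shows "(Y ** transpose Y) \<bullet> (Y ** transpose Y)
       = (transpose Y ** Y) \<bullet> (transpose Y ** Y)"
proof -
  have "(Y ** transpose Y) \<bullet> (Y ** transpose Y)
      = (\<Sum>i\<in>UNIV. \<Sum>j\<in>UNIV. \<Sum>k\<in>UNIV. \<Sum>l\<in>UNIV. Y$i$k * Y$j$k * (Y$i$l * Y$j$l))"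
    by (simp add: inner_vec_def matrix_matrix_mult_def transpose_def sum_product)
  also have "\<dots> = (\<Sum>k\<in>UNIV. \<Sum>l\<in>UNIV. \<Sum>i\<in>UNIV. \<Sum>j\<in>UNIV. Y$i$k * Y$j$k * (Y$i$l * Y$j$l))"
    by (simp only: sum.swap[of _ "UNIV::'r set" "UNIV::'n set"])
  also have "\<dots> = (transpose Y ** Y) \<bullet> (transpose Y ** Y)"
    by (simp add: inner_vec_def matrix_matrix_mult_def transpose_def sum_product ac_simps)
  finally show ?thesis .
qed

text \<open>The squared Frobenius norm of the projection is \<open>CARD('r)\<close>, which the
  factor in \<open>normalized_projection\<close> cancels.\<close>

lemma norm_normalized_projection:
  fixes Y :: "real^'r^'n"
  assumes "orthonormal_columns Y"
  shows "norm (normalized_projection Y) = 1"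
proof -
  have "(mat 1 :: real^'r^'r) \<bullet> mat 1 = real CARD('r)"
    by (simp add: inner_vec_def mat_def if_distrib cong: if_cong)
  then have "(Y ** transpose Y) \<bullet> (Y ** transpose Y) = real CARD('r)"
    using assms by (simp add: inner_matrix_transpose_self orthonormal_columns_def)
  then show ?thesis
    by (simp add: norm_eq_sqrt_inner normalized_projection_def)
qed

text \<open>For unit vectors the squared distance is 2 minus twice the inner product. The squared
  factor \<open>2 powr (- 1 / 2)\<close> halves this, and undoing the normalization contributes
  \<open>CARD('r)\<close>.\<close>

lemma projection_distance_sq:
  fixes Y1 Y2 :: "real^'r^'n"
  assumes "orthonormal_columns Y1" "orthonormal_columns Y2"
  shows "(projection_distance TYPE('r) (column_span Y1) (column_span Y2))\<^sup>2
       = real CARD('r) * (1 - normalized_projection Y1 \<bullet> normalized_projection Y2)"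
proof -
  have diff: "Y1 ** transpose Y1 - Y2 ** transpose Y2
      = sqrt (real CARD('r)) *\<^sub>R (normalized_projection Y1 - normalized_projection Y2)"
    by (simp add: normalized_projection_def flip: scaleR_diff_right)
  have half: "(2 powr (- 1 / 2) :: real)\<^sup>2 = 1 / 2"
    by (simp add: powr_minus_divide powr_half_sqrt power_divide)
  have "(norm (normalized_projection Y1 - normalized_projection Y2))\<^sup>2
      = 2 - 2 * (normalized_projection Y1 \<bullet> normalized_projection Y2)"
    using assms by (simp add: dot_norm_neg norm_normalized_projection field_simps)
  then show ?thesis
    by (simp only: projection_distance_eq[OF assms] diff norm_scaleR power_mult_distrib half) simp
qed

theorem corollary4p5:
  fixes k :: "(real^'n) set \<Rightarrow> (real^'n) set \<Rightarrow> real"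
    and a :: "nat \<Rightarrow> real" and a_minus1 :: real
  assumes "CARD('r::finite) < CARD('n::finite)"
    and "\<And>i. a i \<ge> 0" and "a_minus1 \<ge> 0" and "summable a"
    and "\<And>(Y1 :: real^'r^'n) (Y2 :: real^'r^'n). orthonormal_columns Y1 \<Longrightarrow> orthonormal_columns Y2 \<Longrightarrow>
           k (column_span Y1) (column_span Y2) =
             (\<Sum>i. a i * (normalized_projection Y1 \<bullet> normalized_projection Y2) ^ i)
             + a_minus1 * indicator {1} (normalized_projection Y1 \<bullet> normalized_projection Y2)"
  shows "radial_kernel (grassmannian CARD('r)) (projection_distance TYPE('r)) k \<and>
         positive_definite_kernel (grassmannian CARD('r)) k"
proof
  define F where
    "F t = (\<Sum>i. a i * t ^ i) + a_minus1 * indicator {1} t" for t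
  have k: "k (column_span Y1) (column_span Y2)
      = F (normalized_projection Y1 \<bullet> normalized_projection Y2)"
    if "orthonormal_columns Y1" "orthonormal_columns Y2" for Y1 Y2 :: "real^'r^'n"
    using assms(5)[OF that] by (simp add: F_def)
  show "radial_kernel (grassmannian CARD('r)) (projection_distance TYPE('r)) k"
    unfolding radial_kernel_def
  proof (intro exI ballI)
    fix S T :: "(real^'n) set"
    assume "S \<in> grassmannian CARD('r)" "T \<in> grassmannian CARD('r)"
    then obtain Y1 Y2 :: "real^'r^'n"
      where Y: "orthonormal_columns Y1" "orthonormal_columns Y2"
        and ST: "S = column_span Y1" "T = column_span Y2"
      unfolding grassmannian_eq_column_spans by blast
    \<comment> \<open>The radial profile comes from solving \<open>projection_distance_sq\<close>
      for the inner product.\<close>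
    show "k S T = (\<lambda>d. F (1 - d\<^sup>2 / real CARD('r))) (projection_distance TYPE('r) S T)"
      by (simp add: ST k Y projection_distance_sq)
  qed
  \<comment> \<open>The pullback needs a map on subspaces rather than on representing matrices;
    \<open>projection_matrix\<close> supplies one that is independent of the choice of orthonormal
    basis.\<close>
  define g :: "(real^'n) set \<Rightarrow> real^'n^'n" where
    "g S = (1 / sqrt (real CARD('r))) *\<^sub>R projection_matrix TYPE('r) S" for S
  have g: "g (column_span Y) = normalized_projection Y"
    if "orthonormal_columns Y" for Y :: "real^'r^'n"
    using that by (simp add: g_def projection_matrix_eq normalized_projection_def)
  have "positive_definite_kernel (sphere (0 :: real^'n^'n) 1) (\<lambda>x y. F (x \<bullet> y))"
    unfolding F_def using assms(2-4) by (rule positive_definite_kernel_sphere)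
  then have "positive_definite_kernel (grassmannian CARD('r)) (\<lambda>S T. F (g S \<bullet> g T))"
    by (rule positive_definite_kernel_pullback)
      (auto simp: grassmannian_eq_column_spans g norm_normalized_projection)
  moreover have "F (g S \<bullet> g T) = k S T"
    if "S \<in> grassmannian CARD('r)" "T \<in> grassmannian CARD('r)" for S T
    using that by (auto simp: grassmannian_eq_column_spans g k)
  then have "positive_definite_kernel (grassmannian CARD('r)) (\<lambda>S T. F (g S \<bullet> g T))
      \<longleftrightarrow> positive_definite_kernel (grassmannian CARD('r)) k"
    by (rule positive_definite_kernel_cong)
  ultimately show "positive_definite_kernel (grassmannian CARD('r)) k"
    by simp
qed

end
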